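(* Let $\Sigma$ be a signed graph. If the conflict graph $C(\Sigma)$ is perfect, then $\Sigma$ is balanced-perfect, i.e. $\mathrm{BSTAB}(\Sigma)=\mathrm{BQSTAB}(\Sigma)$. The converse fails in general: there exists a balanced-perfect signed graph $\Sigma$ such that $C(\Sigma)$ is not perfect.
   Context: Signed graphs. A signed graph is a pair $\Sigma=(G,\sigma)$ with $G$ a finite graph and $\sigma:E(G)\to\{+1,-1\}$. Positive loops are allowed, negative loops are excluded; between two distinct vertices there may be both a positive and a negative edge (a digon); repeated edges of the same sign are immaterial. Convention: every signed graph is replaced by its completion having a positive loop at every vertex. A signed graph is balanced if every cycle has positive sign (product of edge signs; a digon is a negative cycle); a set $B\subseteq V(\Sigma)$ is balanced if the induced signed graph $\Sigma[B]$ is balanced. Conflict graph. $C(\Sigma)$ is the ordinary simple graph on $V(\Sigma)\times\{\pm1\}$ with $(u,s)\sim(v,r)$ iff there is an edge $e=uv$ of $\Sigma$ (possibly a loop, $u=v$) with $r=-\sigma(e)s$. In particular $(v,+)\sim(v,-)$ for all $v$. Bodies. For a finite simple graph $H$, $\mathrm{QSTAB}(H)=\{x\ge0: x(K)\le1\text{ for every clique }K\}$, with $x(K)=\sum_{v\in K}x_v$. Let $p:\mathbb R^{V(\Sigma)\times\{\pm1\}}\to\mathbb R^{V(\Sigma)}$, $p(y)_v=y_{(v,+)}+y_{(v,-)}$. Then $\mathrm{BSTAB}(\Sigma)=\operatorname{conv}\{\mathbf 1_B:B\subseteq V(\Sigma)\text{ balanced}\}$ and $\mathrm{BQSTAB}(\Sigma)=p(\mathrm{QSTAB}(C(\Sigma)))$.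 A signed graph $\Sigma$ is balanced-perfect if $\mathrm{BSTAB}(\Sigma)=\mathrm{BQSTAB}(\Sigma)$. *)

theory Defs
  imports "HOL-Analysis.Analysis" "HOL-Analysis.Finite_Function_Topology" "HOL-Library.Ramsey"
begin

section \<open>Finite simple graphs\<close>

text \<open>A simple graph is a pair of a vertex set and a set of two-element edges.
  Cliques are those of \<^theory>\<open>HOL-Library.Ramsey\<close>.\<close>

type_synonym 'a ugraph = "'a set \<times> 'a set set"

definition simple_graph :: "'a ugraph \<Rightarrow> bool" where
  "simple_graph H \<longleftrightarrow> finite (fst H) \<and> (\<forall>e\<in>snd H. e \<subseteq> fst H \<and> card e = 2)"

definition induced_subgraph :: "'a ugraph \<Rightarrow> 'a set \<Rightarrow> 'a ugraph" where
  "induced_subgraph H W = (W, {e \<in> snd H. e \<subseteq> W})"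

definition is_clique :: "'a ugraph \<Rightarrow> 'a set \<Rightarrow> bool" where
  "is_clique H K \<longleftrightarrow> K \<subseteq> fst H \<and> clique K (snd H)"

definition clique_number :: "'a ugraph \<Rightarrow> nat" where
  "clique_number H = Max {card K | K. is_clique H K}"

definition proper_colouring :: "'a ugraph \<Rightarrow> nat \<Rightarrow> ('a \<Rightarrow> nat) \<Rightarrow> bool" where
  "proper_colouring H k c \<longleftrightarrow>
     c ` fst H \<subseteq> {..<k} \<and> (\<forall>u\<in>fst H. \<forall>v\<in>fst H. {u, v} \<in> snd H \<longrightarrow> c u \<noteq> c v)"

definition chromatic_number :: "'a ugraph \<Rightarrow> nat" where
  "chromatic_number H = (LEAST k. \<exists>c. proper_colouring H k c)"

definition perfect :: "'a ugraph \<Rightarrow> bool" where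
  "perfect H \<longleftrightarrow> (\<forall>W\<subseteq>fst H.
     chromatic_number (induced_subgraph H W) = clique_number (induced_subgraph H W))"

text \<open>The space of real vectors indexed by a finite set \<open>V\<close> is represented by the finitely
  supported functions \<open>x :: 'a \<Rightarrow>\<^sub>0 real\<close> with \<open>keys x \<subseteq> V\<close>; the vector space structure is that of
  \<^theory>\<open>HOL-Analysis.Finite_Function_Topology\<close>.\<close>

definition qstab :: "'a ugraph \<Rightarrow> ('a \<Rightarrow>\<^sub>0 real) set" where
  "qstab H = {x. Poly_Mapping.keys x \<subseteq> fst H
      \<and> (\<forall>v\<in>fst H. 0 \<le> Poly_Mapping.lookup x v)
      \<and> (\<forall>K. is_clique H K \<longrightarrow> (\<Sum>v\<in>K. Poly_Mapping.lookup x v) \<le> 1)}"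


section \<open>Signed graphs\<close>

text \<open>The underlying graph is a multigraph: edges are abstract, and \<open>ends e\<close> is the set of
  endpoints of \<open>e\<close>, a singleton if \<open>e\<close> is a loop.\<close>

record ('v, 'e) sgraph =
  sverts :: "'v set"
  sedges :: "'e set"
  ends :: "'e \<Rightarrow> 'v set"
  esign :: "'e \<Rightarrow> int"

text \<open>The last assumption is the standing convention that signed graphs are completed: there is
  a positive loop at every vertex.\<close>

locale signed_graph =
  fixes \<Sigma> :: "('v, 'e) sgraph"
  assumes finite_sverts: "finite (sverts \<Sigma>)"
    and finite_sedges: "finite (sedges \<Sigma>)"
    and ends_in_sverts: "e \<in> sedges \<Sigma> \<Longrightarrow> \<exists>u\<in>sverts \<Sigma>. \<exists>v\<in>sverts \<Sigma>. ends \<Sigma> e = {u, v}"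
    and esign_values: "e \<in> sedges \<Sigma> \<Longrightarrow> esign \<Sigma> e \<in> {1, -1}"
    and no_negative_loop: "e \<in> sedges \<Sigma> \<Longrightarrow> ends \<Sigma> e = {v} \<Longrightarrow> esign \<Sigma> e = 1"
    and positive_loop: "v \<in> sverts \<Sigma> \<Longrightarrow> \<exists>e\<in>sedges \<Sigma>. ends \<Sigma> e = {v} \<and> esign \<Sigma> e = 1"

definition induced_sgraph :: "('v, 'e) sgraph \<Rightarrow> 'v set \<Rightarrow> ('v, 'e) sgraph" where
  "induced_sgraph \<Sigma> B = \<Sigma>\<lparr>sverts := B, sedges := {e \<in> sedges \<Sigma>. ends \<Sigma> e \<subseteq> B}\<rparr>"

text \<open>The edge \<open>es ! i\<close> joins \<open>vs ! i\<close> to the cyclically next vertex. Cycles of length one are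
  loops; cycles of length two consist of two distinct parallel edges, e.g. a digon.\<close>

definition is_cycle :: "('v, 'e) sgraph \<Rightarrow> 'v list \<Rightarrow> 'e list \<Rightarrow> bool" where
  "is_cycle \<Sigma> vs es \<longleftrightarrow>
     vs \<noteq> [] \<and> length es = length vs \<and> distinct vs \<and> distinct es
     \<and> set vs \<subseteq> sverts \<Sigma> \<and> set es \<subseteq> sedges \<Sigma>
     \<and> (\<forall>i<length vs. ends \<Sigma> (es ! i) = {vs ! i, vs ! (Suc i mod length vs)})"

definition balanced :: "('v, 'e) sgraph \<Rightarrow> bool" where
  "balanced \<Sigma> \<longleftrightarrow> (\<forall>vs es. is_cycle \<Sigma> vs es \<longrightarrow> prod_list (map (esign \<Sigma>) es) = 1)"

definition balanced_set :: "('v, 'e) sgraph \<Rightarrow> 'v set \<Rightarrow> bool" where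
  "balanced_set \<Sigma> B \<longleftrightarrow> B \<subseteq> sverts \<Sigma> \<and> balanced (induced_sgraph \<Sigma> B)"

definition conflict_graph :: "('v, 'e) sgraph \<Rightarrow> ('v \<times> int) ugraph" where
  "conflict_graph \<Sigma> =
     (sverts \<Sigma> \<times> {1, -1},
      {{(u, s), (v, r)} | u s v r. s \<in> {1, -1} \<and>
         (\<exists>e\<in>sedges \<Sigma>. ends \<Sigma> e = {u, v} \<and> r = - esign \<Sigma> e * s)})"

text \<open>Absence of negative loops makes the conflict graph loopless.\<close>

lemma (in signed_graph) simple_graph_conflict_graph: "simple_graph (conflict_graph \<Sigma>)"
proof -
  have "{(u, s), (v, - esign \<Sigma> e * s)} \<subseteq> sverts \<Sigma> \<times> {1, -1}
      \<and> card {(u, s), (v, - esign \<Sigma> e * s)} = 2"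
    if "s \<in> {1, -1}" "e \<in> sedges \<Sigma>" "ends \<Sigma> e = {u, v}" for u s v e
    using that ends_in_sverts[of e] esign_values[of e] no_negative_loop[of e u]
    by (auto simp: card_insert_if doubleton_eq_iff)
  then show ?thesis
    using finite_sverts unfolding simple_graph_def conflict_graph_def by fastforce
qed

definition indicator_vec :: "'v set \<Rightarrow> ('v \<Rightarrow>\<^sub>0 real)" where
  "indicator_vec B = (\<Sum>v\<in>B. Poly_Mapping.single v 1)"

definition bstab :: "('v, 'e) sgraph \<Rightarrow> ('v \<Rightarrow>\<^sub>0 real) set" where
  "bstab \<Sigma> = convex hull {indicator_vec B | B. balanced_set \<Sigma> B}"

definition proj :: "('v, 'e) sgraph \<Rightarrow> ('v \<times> int \<Rightarrow>\<^sub>0 real) \<Rightarrow> ('v \<Rightarrow>\<^sub>0 real)" where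
  "proj \<Sigma> y = (\<Sum>v\<in>sverts \<Sigma>. Poly_Mapping.single v
     (Poly_Mapping.lookup y (v, 1) + Poly_Mapping.lookup y (v, -1)))"

definition bqstab :: "('v, 'e) sgraph \<Rightarrow> ('v \<Rightarrow>\<^sub>0 real) set" where
  "bqstab \<Sigma> = proj \<Sigma> ` qstab (conflict_graph \<Sigma>)"

definition balanced_perfect :: "('v, 'e) sgraph \<Rightarrow> bool" where
  "balanced_perfect \<Sigma> \<longleftrightarrow> bstab \<Sigma> = bqstab \<Sigma>"

end

theory Submission
  imports Defs
begin

text \<open>For a perfect graph, rounding a point of QSTAB to multiples of \<open>1/n\<close> and colouring the
  corresponding weighted graph with \<open>n\<close> stable sets exhibits the rounded point as an average of
  stable sets; as \<open>n\<close> grows, compactness of the stable set polytope gives QSTAB = STAB. Stable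
  sets of the conflict graph are the switching functions of balanced sets (Harary), so the
  projection sends STAB of the conflict graph onto BSTAB. For the failure of the converse, a
  signed graph on four vertices is taken whose conflict graph contains an induced 5-cycle
  running through both copies of one vertex; its only unbalanced sets are those containing a
  negative triangle, and the corresponding inequality is already implied by two cliques.\<close>

section \<open>Perfect graphs\<close>

lemma lookup_scaleR [simp]:
  "Poly_Mapping.lookup (c *\<^sub>R x) v = c *\<^sub>R Poly_Mapping.lookup x v"
  by (simp add: scaleR_poly_mapping_def Poly_Mapping.map.rep_eq when_def)

lemma lookup_indicator_vec:
  assumes "finite B"
  shows "Poly_Mapping.lookup (indicator_vec B) v = (if v \<in> B then 1 else 0)"
  using assms by (simp add: indicator_vec_def lookup_sum lookup_single when_def)

definition stable_set :: "'a ugraph \<Rightarrow> 'a set \<Rightarrow> bool" where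
  "stable_set H S \<longleftrightarrow> S \<subseteq> fst H \<and> indep S (snd H)"

definition stab :: "'a ugraph \<Rightarrow> ('a \<Rightarrow>\<^sub>0 real) set" where
  "stab H = convex hull {indicator_vec S | S. stable_set H S}"

lemma card_clique_Int_stable_set:
  assumes "is_clique H K" "stable_set H S"
  shows "card (K \<inter> S) \<le> 1"
proof -
  have "x = y" if "x \<in> K \<inter> S" "y \<in> K \<inter> S" for x y
    using that assms unfolding is_clique_def clique_def stable_set_def indep_def by blast
  then show ?thesis
    by (metis card.infinite card_le_Suc0_iff_eq One_nat_def zero_le_one)
qed

lemma perfect_colouring:
  assumes H: "simple_graph H" "perfect H" and W: "W \<subseteq> fst H"
    and q: "\<And>K. is_clique H K \<Longrightarrow> K \<subseteq> W \<Longrightarrow> card K \<le> q"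
  shows "\<exists>c. proper_colouring (induced_subgraph H W) q c"
proof -
  let ?G = "induced_subgraph H W"
  have fin: "finite W" using H(1) W finite_subset unfolding simple_graph_def by blast
  have cl: "is_clique H K \<and> K \<subseteq> W" if "is_clique ?G K" for K
    using that W unfolding is_clique_def induced_subgraph_def clique_def by auto
  have "finite {card K | K. is_clique ?G K}"
    using fin by (auto simp: is_clique_def induced_subgraph_def intro!: finite_image_set)
  moreover have "is_clique ?G {}" by (simp add: is_clique_def)
  ultimately have "clique_number ?G \<le> q"
    unfolding clique_number_def using cl q by (subst Max_le_iff) auto
  then have le: "chromatic_number ?G \<le> q"
    using H(2) W unfolding perfect_def by simp
  \<comment> \<open>The \<open>LEAST\<close> in \<open>chromatic_number\<close> needs a witness: an
    injective numbering is proper because \<open>H\<close> has no loops.\<close>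
  obtain f :: "'a \<Rightarrow> nat" and k where f: "f ` W = {..<k}" "inj_on f W"
    using finite_imp_inj_to_nat_seg[OF fin] by (auto simp: lessThan_def)
  have "{u, u} \<notin> snd H" for u using H(1) unfolding simple_graph_def by fastforce
  then have "proper_colouring ?G k f"
    using f unfolding proper_colouring_def induced_subgraph_def by (auto simp: inj_on_eq_iff)
  then have "\<exists>k c. proper_colouring ?G k c" by blast
  then have "\<exists>c. proper_colouring ?G (chromatic_number ?G) c"
    unfolding chromatic_number_def by (rule LeastI_ex)
  moreover have "{..<chromatic_number ?G} \<subseteq> {..<q}" using le by simp
  ultimately show ?thesis unfolding proper_colouring_def by (meson subset_trans)
qed

text \<open>The induction step is Lovasz's replication argument.\<close>

lemma perfect_weighted_colouring:
  fixes w :: "'a \<Rightarrow> nat"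
  assumes H: "simple_graph H" "perfect H"
    and "\<And>K. is_clique H K \<Longrightarrow> sum w K \<le> q"
  shows "\<exists>S. (\<forall>i<q. stable_set H (S i)) \<and> (\<forall>v\<in>fst H. card {i. i < q \<and> v \<in> S i} = w v)"
  using assms(3)
proof (induction "sum w (fst H)" arbitrary: w q rule: less_induct)
  case less
  have fin: "finite (fst H)" using H(1) by (simp add: simple_graph_def)
  have fink: "finite K" if "is_clique H K" for K
    using that fin finite_subset unfolding is_clique_def by blast
  show ?case
  proof (cases "\<forall>v\<in>fst H. w v \<le> 1")
    case True
    \<comment> \<open>All weights are 0 or 1, so the classes of an ordinary colouring of the
      vertices of weight 1 suffice.\<close>
    define W where "W = {v \<in> fst H. w v = 1}"
    have "card K \<le> q" if K: "is_clique H K" "K \<subseteq> W" for K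
    proof -
      have "sum w K = card K" using K(2) by (subst card_eq_sum, intro sum.cong) (auto simp: W_def)
      with less.prems[OF K(1)] show ?thesis by simp
    qed
    then obtain c where c: "proper_colouring (induced_subgraph H W) q c"
      using perfect_colouring[OF H, of W q] by (auto simp: W_def)
    define S where "S i = {v \<in> W. c v = i}" for i
    have "stable_set H (S i)" for i
      using c unfolding stable_set_def indep_def S_def proper_colouring_def induced_subgraph_def
      by (fastforce simp: W_def)
    moreover have "card {i. i < q \<and> v \<in> S i} = w v" if v: "v \<in> fst H" for v
    proof (cases "v \<in> W")
      case True
      then have "{i. i < q \<and> v \<in> S i} = {c v}"
        using c unfolding S_def proper_colouring_def induced_subgraph_def by auto
      then show ?thesis using True by (simp add: W_def)
    next
      case False
      then show ?thesis using v \<open>\<forall>v\<in>fst H. w v \<le> 1\<close>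
        by (auto simp: S_def W_def le_Suc_eq)
    qed
    ultimately show ?thesis by blast
  next
    case False
    then obtain v where v: "v \<in> fst H" "w v \<ge> 2" by force
    \<comment> \<open>One copy of \<open>v\<close> is removed. Since \<open>w' v\<close> is still at
      least 1, one of the \<open>q\<close> stable sets obtained for \<open>w'\<close> passes through
      \<open>v\<close>.\<close>
    define w' where "w' = w(v := w v - 1)"
    have w'_le: "sum w' K \<le> sum w K" for K by (rule sum_mono) (simp add: w'_def)
    have w'_v: "sum w K = Suc (sum w' K)" if "finite K" "v \<in> K" for K
    proof -
      have "sum w K = w v + sum w (K - {v})" using that by (simp add: sum.remove)
      moreover have "sum w' K = w' v + sum w' (K - {v})" using that by (simp add: sum.remove)
      moreover have "sum w' (K - {v}) = sum w (K - {v})" by (rule sum.cong) (auto simp: w'_def)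
      ultimately show ?thesis using v(2) by (simp add: w'_def)
    qed
    have less': "sum w' (fst H) < sum w (fst H)" using w'_v[OF fin v(1)] by simp
    obtain S where S: "\<And>i. i < q \<Longrightarrow> stable_set H (S i)"
        "\<And>u. u \<in> fst H \<Longrightarrow> card {i. i < q \<and> u \<in> S i} = w' u"
      using less.hyps[OF less', of q] less.prems w'_le by (meson le_trans)
    have "card {i. i < q \<and> v \<in> S i} \<noteq> 0" using S(2)[OF v(1)] v(2) by (simp add: w'_def)
    then have "{i. i < q \<and> v \<in> S i} \<noteq> {}" by (metis card.empty)
    then obtain j where j: "j < q" "v \<in> S j" by blast
    define A where "A = S j"
    have A: "stable_set H A" "v \<in> A" using S(1) j by (auto simp: A_def)
    \<comment> \<open>The weight left for \<open>q - 1\<close> stable sets once \<open>A\<close> is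
      set aside. \<open>v\<close> is spared because \<open>w'\<close> has already given up the copy
      of \<open>v\<close> that \<open>A\<close> will cover.\<close>
    define w'' where "w'' u = (if u \<in> A - {v} then w' u - 1 else w' u)" for u
    have w'_pos: "w' u \<ge> 1" if "u \<in> A" for u
    proof -
      have "u \<in> fst H" using that A(1) by (auto simp: stable_set_def)
      moreover have "j \<in> {i. i < q \<and> u \<in> S i}" using that j(1) by (simp add: A_def)
      moreover from this have "0 < card {i. i < q \<and> u \<in> S i}" by (subst card_gt_0_iff) auto
      ultimately show ?thesis using S(2)[of u] by simp
    qed
    have "sum w'' (fst H) \<le> sum w' (fst H)" by (rule sum_mono) (simp add: w''_def)
    then have less'': "sum w'' (fst H) < sum w (fst H)" using less' by simp
    have "sum w'' K \<le> q - 1" if K: "is_clique H K" for K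
    proof -
      have le: "sum w'' K \<le> sum w' K" by (rule sum_mono) (simp add: w''_def)
      show ?thesis
      proof (cases "sum w' K = q")
        case True
        \<comment> \<open>A clique through \<open>v\<close> has \<open>w\<close>-weight one above
          its \<open>w'\<close>-weight, so it would exceed \<open>q\<close>.\<close>
        have "v \<notin> K" using w'_v[OF fink[OF K]] less.prems[OF K] True by auto
        \<comment> \<open>Double counting: the \<open>q\<close> intersections of \<open>K\<close>
          with the \<open>S i\<close> have total size \<open>q\<close> and at most one element each,
          so none is empty. In particular \<open>K\<close> meets \<open>A\<close>.\<close>
        have "(\<Sum>i<q. card (K \<inter> S i)) = (\<Sum>i<q. \<Sum>u\<in>K. if u \<in> S i then 1 else 0)"
          using fink[OF K] by (intro sum.cong refl) (simp add: sum.If_cases Int_def)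
        also have "\<dots> = (\<Sum>u\<in>K. \<Sum>i<q. if u \<in> S i then 1 else 0)" by (rule sum.swap)
        also have "\<dots> = (\<Sum>u\<in>K. card {i. i < q \<and> u \<in> S i})"
          by (intro sum.cong refl) (simp add: sum.If_cases Int_def)
        also have "\<dots> = sum w' K" using K S(2) by (intro sum.cong) (auto simp: is_clique_def)
        finally have "(\<Sum>i<q. card (K \<inter> S i)) = q" using True by simp
        moreover have "card (K \<inter> S i) \<le> 1" if "i < q" for i
          using card_clique_Int_stable_set[OF K S(1)[OF that]] .
        ultimately have "card (K \<inter> S j) \<noteq> 0"
          using sum_strict_mono_ex1[of "{..<q}" "\<lambda>i. card (K \<inter> S i)" "\<lambda>_. 1"] j(1)
          by fastforce
        then obtain u where u: "u \<in> K" "u \<in> A" by (auto simp: A_def card_eq_0_iff)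
        then have "w'' u < w' u" using \<open>v \<notin> K\<close> w'_pos[of u] by (auto simp: w''_def)
        moreover have "\<forall>u\<in>K. w'' u \<le> w' u" by (simp add: w''_def)
        ultimately have "sum w'' K < sum w' K"
          using u(1) by (intro sum_strict_mono_ex1 fink[OF K]) auto
        then show ?thesis using True by simp
      next
        case False
        then show ?thesis using le w'_le[of K] less.prems[OF K] by linarith
      qed
    qed
    then obtain T where T: "\<And>i. i < q - 1 \<Longrightarrow> stable_set H (T i)"
        "\<And>u. u \<in> fst H \<Longrightarrow> card {i. i < q - 1 \<and> u \<in> T i} = w'' u"
      using less.hyps[OF less'', of "q - 1"] by meson
    \<comment> \<open>\<open>A\<close> takes the free index \<open>q - 1\<close>;
      \<open>j < q\<close> ensures that \<open>q\<close> is positive.\<close>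
    define U where "U = T(q - 1 := A)"
    have "stable_set H (U i)" if "i < q" for i
      using that T(1)[of i] A(1) by (auto simp: U_def)
    moreover have "card {i. i < q \<and> u \<in> U i} = w u" if u: "u \<in> fst H" for u
    proof -
      have "{i. i < q \<and> u \<in> U i} =
          {i. i < q - 1 \<and> u \<in> T i} \<union> (if u \<in> A then {q - 1} else {})"
        using j(1) by (auto simp: U_def)
      then have "card {i. i < q \<and> u \<in> U i} = w'' u + (if u \<in> A then 1 else 0)"
        unfolding T(2)[OF u, symmetric] by (simp add: card_insert_if)
      then show ?thesis using w'_pos[of u] v(2) A(2) by (auto simp: w''_def w'_def)
    qed
    ultimately show ?thesis by blast
  qed
qed

theorem perfect_qstab_subset_stab:
  assumes H: "simple_graph H" "perfect H"
  shows "qstab H \<subseteq> stab H"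
proof
  fix x assume x: "x \<in> qstab H"
  have fin: "finite (fst H)" using H(1) by (simp add: simple_graph_def)
  let ?I = "{indicator_vec S | S. stable_set H S} :: ('a \<Rightarrow>\<^sub>0 real) set"
  have "finite {S. stable_set H S}"
    by (rule finite_subset[of _ "Pow (fst H)"]) (auto simp: stable_set_def fin)
  \<comment> \<open>A hull of finitely many points is compact, so limits of its points stay
    inside.\<close>
  then have "closed (stab H)"
    unfolding stab_def by (intro compact_imp_closed finite_imp_compact_convex_hull) auto
  \<comment> \<open>Floors can only lower the clique sums; \<open>Suc n\<close> keeps the
    denominator nonzero.\<close>
  define N where "N n v = nat \<lfloor>real (Suc n) * Poly_Mapping.lookup x v\<rfloor>" for n v
  \<comment> \<open>Expanding \<open>y n\<close> in unit vectors, like \<open>x\<close> below,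
    reduces convergence to finitely many real coefficients.\<close>
  define y where "y n = (\<Sum>v\<in>fst H. (real (N n v) / real (Suc n)) *\<^sub>R
    (Poly_Mapping.single v 1 :: 'a \<Rightarrow>\<^sub>0 real))" for n
  have zero: "Poly_Mapping.lookup x v = 0" if "v \<notin> fst H" for v
    using x that not_in_keys_iff_lookup_eq_zero[of v x] by (auto simp: qstab_def)
  have nonneg: "0 \<le> Poly_Mapping.lookup x v" for v
    using x zero[of v] by (cases "v \<in> fst H") (auto simp: qstab_def)
  have x_eq: "x = (\<Sum>v\<in>fst H. Poly_Mapping.lookup x v *\<^sub>R (Poly_Mapping.single v 1 :: 'a \<Rightarrow>\<^sub>0 real))"
  proof (rule poly_mapping_eqI)
    fix v
    show "Poly_Mapping.lookup x v = Poly_Mapping.lookup (\<Sum>v\<in>fst H.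
        Poly_Mapping.lookup x v *\<^sub>R (Poly_Mapping.single v 1 :: 'a \<Rightarrow>\<^sub>0 real)) v"
      using fin zero[of v] by (simp add: lookup_sum lookup_single when_def if_distrib cong: if_cong)
  qed
  have "y n \<in> stab H" for n
  proof -
    have "sum (N n) K \<le> Suc n" if K: "is_clique H K" for K
    proof -
      have "real (sum (N n) K) \<le> (\<Sum>v\<in>K. real (Suc n) * Poly_Mapping.lookup x v)"
        using nonneg by (simp add: N_def) (intro sum_mono of_int_floor_le)
      also have "\<dots> = real (Suc n) * (\<Sum>v\<in>K. Poly_Mapping.lookup x v)"
        by (simp add: sum_distrib_left)
      also have "\<dots> \<le> real (Suc n) * 1"
        using x K by (intro mult_left_mono) (auto simp: qstab_def)
      finally show ?thesis by (simp only: mult_1_right of_nat_le_iff)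
    qed
    then obtain S where S: "\<And>i. i < Suc n \<Longrightarrow> stable_set H (S i)"
        "\<And>v. v \<in> fst H \<Longrightarrow> card {i. i < Suc n \<and> v \<in> S i} = N n v"
      using perfect_weighted_colouring[OF H, of "N n" "Suc n"] by meson
    have finS: "finite (S i)" if "i < Suc n" for i
      using S(1)[OF that] fin finite_subset unfolding stable_set_def by blast
    \<comment> \<open>Each vertex \<open>v\<close> of \<open>H\<close> lies in \<open>N n v\<close>
      of the \<open>Suc n\<close> stable sets, so their average is \<open>y n\<close>.\<close>
    have "y n = (\<Sum>i<Suc n. (1 / real (Suc n)) *\<^sub>R indicator_vec (S i))"
    proof (rule poly_mapping_eqI)
      fix v
      have "Poly_Mapping.lookup (\<Sum>i<Suc n. (1 / real (Suc n)) *\<^sub>R indicator_vec (S i)) v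
          = (\<Sum>i<Suc n. if v \<in> S i then 1 / real (Suc n) else 0)"
        unfolding lookup_sum by (intro sum.cong refl) (simp add: lookup_indicator_vec finS)
      also have "\<dots> = real (card {i. i < Suc n \<and> v \<in> S i}) / real (Suc n)"
        by (simp only: sum.If_cases finite_lessThan Int_def) simp
      also have "\<dots> = Poly_Mapping.lookup (y n) v"
      proof (cases "v \<in> fst H")
        case True
        then show ?thesis using fin S(2)
          by (simp add: y_def lookup_sum lookup_single when_def if_distrib cong: if_cong)
      next
        case False
        then have "{i. i < Suc n \<and> v \<in> S i} = {}" using S(1) unfolding stable_set_def by blast
        then show ?thesis using fin False
          by (simp add: y_def lookup_sum lookup_single when_def if_distrib cong: if_cong)
      qed
      finally show "Poly_Mapping.lookup (y n) v =
        Poly_Mapping.lookup (\<Sum>i<Suc n. (1 / real (Suc n)) *\<^sub>R indicator_vec (S i)) v" by simp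
    qed
    also have "\<dots> \<in> stab H"
      unfolding stab_def
    proof (rule convex_sum)
      show "indicator_vec (S i) \<in> convex hull ?I" if "i \<in> {..<Suc n}" for i
        using that S(1) by (intro hull_inc) auto
    qed (auto simp: convex_convex_hull)
    finally show ?thesis .
  qed
  moreover have "(\<lambda>n. real (N n v) / real (Suc n)) \<longlonglongrightarrow> Poly_Mapping.lookup x v" for v
  proof (rule tendsto_sandwich)
    let ?c = "Poly_Mapping.lookup x v"
    have fl: "real (N n v) = real_of_int \<lfloor>real (Suc n) * ?c\<rfloor>" for n
      using nonneg[of v] by (simp add: N_def)
    show "\<forall>\<^sub>F n in sequentially. ?c - 1 / real (Suc n) \<le> real (N n v) / real (Suc n)"
    proof (rule always_eventually, rule allI)
      fix n
      have "real (Suc n) * ?c - 1 \<le> real (N n v)" unfolding fl by linarith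
      then show "?c - 1 / real (Suc n) \<le> real (N n v) / real (Suc n)"
        by (subst pos_le_divide_eq) (simp_all add: right_diff_distrib mult.commute del: of_nat_Suc)
    qed
    show "\<forall>\<^sub>F n in sequentially. real (N n v) / real (Suc n) \<le> ?c"
      unfolding fl by (rule always_eventually) (simp add: divide_le_eq mult.commute del: of_nat_Suc)
    show "(\<lambda>n. ?c - 1 / real (Suc n)) \<longlonglongrightarrow> ?c"
      using tendsto_diff[OF tendsto_const LIMSEQ_inverse_real_of_nat, of ?c]
      by (simp add: inverse_eq_divide)
  qed auto
  then have "y \<longlonglongrightarrow> (\<Sum>v\<in>fst H. Poly_Mapping.lookup x v *\<^sub>R
      (Poly_Mapping.single v 1 :: 'a \<Rightarrow>\<^sub>0 real))"
    unfolding y_def by (intro tendsto_sum tendsto_scaleR tendsto_const)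
  ultimately show "x \<in> stab H"
    using \<open>closed (stab H)\<close> x_eq closed_sequentially by metis
qed

section \<open>Switching\<close>

text \<open>A certificate of balance: switching at the vertices with \<open>s v = -1\<close> makes
  every edge positive. Signs are given to all elements of the vertex type, which avoids side
  conditions on endpoints.\<close>

definition switching :: "('v, 'e) sgraph \<Rightarrow> ('v \<Rightarrow> int) \<Rightarrow> bool" where
  "switching \<Sigma> s \<longleftrightarrow> (\<forall>v. s v \<in> {1, -1}) \<and>
     (\<forall>e\<in>sedges \<Sigma>. \<forall>u v. ends \<Sigma> e = {u, v} \<longrightarrow> esign \<Sigma> e = s u * s v)"

text \<open>The easy half of Harary's theorem: every vertex of a cycle contributes its sign twice to
  the product.\<close>

lemma switching_imp_balanced:
  assumes "switching \<Sigma> s"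
  shows "balanced \<Sigma>"
  unfolding balanced_def
proof (intro allI impI)
  fix vs es assume c: "is_cycle \<Sigma> vs es"
  then obtain m where m: "length vs = Suc m" by (cases vs) (auto simp: is_cycle_def)
  have sq: "s v * s v = 1" for v using assms by (auto simp: switching_def dest: spec[of _ v])
  let ?g = "\<lambda>i. s (vs ! i)"
  have "prod_list (map (esign \<Sigma>) es) = (\<Prod>i<Suc m. esign \<Sigma> (es ! i))"
    using c m by (simp add: prod.list_conv_set_nth is_cycle_def atLeast0LessThan)
  also have "\<dots> = (\<Prod>i<Suc m. ?g i * ?g (Suc i mod Suc m))"
  proof (rule prod.cong)
    fix i assume "i \<in> {..<Suc m}"
    then have "es ! i \<in> sedges \<Sigma>" "ends \<Sigma> (es ! i) = {vs ! i, vs ! (Suc i mod Suc m)}"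
      using c m by (auto simp: is_cycle_def)
    then show "esign \<Sigma> (es ! i) = ?g i * ?g (Suc i mod Suc m)"
      using assms by (simp add: switching_def)
  qed simp
  also have "\<dots> = (\<Prod>i<Suc m. ?g i) * (\<Prod>i<Suc m. ?g (Suc i mod Suc m))"
    by (rule prod.distrib)
  \<comment> \<open>The index wraps around only at \<open>m\<close>, where it gives
    \<open>?g 0\<close>; the product is a cyclic shift of the product of all
    \<open>?g i\<close>.\<close>
  also have "(\<Prod>i<Suc m. ?g (Suc i mod Suc m)) = (\<Prod>i<m. ?g (Suc i)) * ?g 0"
    by (simp add: prod.lessThan_Suc)
  also have "\<dots> = (\<Prod>i<Suc m. ?g i)"
    by (subst prod.lessThan_Suc_shift) (simp add: mult.commute)
  also have "(\<Prod>i<Suc m. ?g i) * (\<Prod>i<Suc m. ?g i) = 1"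
    by (simp only: prod.distrib[symmetric] sq) simp
  finally show "prod_list (map (esign \<Sigma>) es) = 1" .
qed

section \<open>Simple paths and the cycles they close\<close>

definition simple_path ::
    "('v, 'e) sgraph \<Rightarrow> 'e set \<Rightarrow> 'v \<Rightarrow> 'v list \<Rightarrow> 'e list \<Rightarrow> bool" where
  "simple_path \<Sigma> F a vs es \<longleftrightarrow> length vs = Suc (length es) \<and> vs ! 0 = a \<and> distinct vs
     \<and> set es \<subseteq> F \<and> (\<forall>i<length es. ends \<Sigma> (es ! i) = {vs ! i, vs ! Suc i})"

text \<open>If \<open>v\<close> already lies on the path, the path is cut off there; otherwise the
  edge is appended. Hence the set of vertices reached by simple paths is closed under edges of
  \<open>F\<close>.\<close>

lemma simple_path_extend:
  assumes p: "simple_path \<Sigma> F a vs es" and f: "f \<in> F" "ends \<Sigma> f = {last vs, v}"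
  shows "\<exists>vs' es'. simple_path \<Sigma> F a vs' es' \<and> last vs' = v"
proof (cases "v \<in> set vs")
  case True
  then obtain k where k: "k < length vs" "vs ! k = v" by (auto simp: in_set_conv_nth)
  have "simple_path \<Sigma> F a (take (Suc k) vs) (take k es)"
    using p k(1) set_take_subset[of k es] unfolding simple_path_def by auto
  moreover have "last (take (Suc k) vs) = v" using k by (simp add: take_Suc_conv_app_nth)
  ultimately show ?thesis by blast
next
  case False
  have len: "length vs = Suc (length es)" using p by (simp add: simple_path_def)
  then have lst: "last vs = vs ! length es" by (subst last_conv_nth) auto
  have "ends \<Sigma> ((es @ [f]) ! i) = {(vs @ [v]) ! i, (vs @ [v]) ! Suc i}"
    if "i < Suc (length es)" for i
  proof (cases "i = length es")
    case True
    then show ?thesis using f(2) len lst by (simp add: nth_append)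
  next
    case False
    then have "i < length es" using that by simp
    then show ?thesis using p len by (simp add: nth_append simple_path_def)
  qed
  then have "simple_path \<Sigma> F a (vs @ [v]) (es @ [f])"
    using p f(1) False len by (auto simp: simple_path_def nth_append)
  then show ?thesis by fastforce
qed

text \<open>A repeated edge would give two positions the same pair of consecutive vertices, which
  distinctness of \<open>vs\<close> forbids.\<close>

lemma simple_path_distinct_edges:
  assumes "simple_path \<Sigma> F a vs es"
  shows "distinct es"
  unfolding distinct_conv_nth
proof (intro allI impI notI)
  fix i j assume ij: "i < length es" "j < length es" "i \<noteq> j" "es ! i = es ! j"
  then have eq: "{vs ! i, vs ! Suc i} = {vs ! j, vs ! Suc j}"
    using assms unfolding simple_path_def by metis
  have inj: "vs ! k = vs ! l \<longleftrightarrow> k = l" if "k \<le> length es" "l \<le> length es" for k l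
    using assms that by (auto simp: simple_path_def nth_eq_iff_index_eq)
  from eq ij show False by (auto simp: doubleton_eq_iff inj)
qed

lemma prod_switching_telescope:
  fixes g :: "nat \<Rightarrow> int"
  assumes "\<And>i. g i * g i = 1"
  shows "(\<Prod>i<m. g i * g (Suc i)) = g 0 * g m"
proof (induction m)
  case 0
  then show ?case using assms by simp
next
  case (Suc m)
  have "g 0 * g m * (g m * g (Suc m)) = g 0 * (g m * g m) * g (Suc m)" by (simp only: mult.assoc)
  then show ?case using Suc assms by (simp add: prod.lessThan_Suc)
qed

text \<open>The signs of inner vertices cancel in pairs.\<close>

lemma simple_path_sign:
  assumes p: "simple_path \<Sigma> F a vs es"
    and s: "\<And>v. s v \<in> {1, -1}"
    and F: "\<And>f u v. f \<in> F \<Longrightarrow> ends \<Sigma> f = {u, v} \<Longrightarrow> esign \<Sigma> f = s u * s v"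
  shows "prod_list (map (esign \<Sigma>) es) = s a * s (last vs)"
proof -
  have sq: "s v * s v = 1" for v using s[of v] by auto
  have "prod_list (map (esign \<Sigma>) es) = (\<Prod>i<length es. esign \<Sigma> (es ! i))"
    by (simp add: prod.list_conv_set_nth atLeast0LessThan)
  also have "\<dots> = (\<Prod>i<length es. s (vs ! i) * s (vs ! Suc i))"
    using p by (intro prod.cong refl F) (auto simp: simple_path_def)
  also have "\<dots> = s (vs ! 0) * s (vs ! length es)"
    by (rule prod_switching_telescope[of "\<lambda>i. s (vs ! i)"]) (rule sq)
  also have "vs ! length es = last vs"
    using p by (subst last_conv_nth) (auto simp: simple_path_def)
  finally show ?thesis using p by (simp add: simple_path_def)
qed

text \<open>\<open>e \<notin> F\<close> keeps the edge list distinct even when \<open>e\<close> is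
  parallel to an edge of the path, as in a digon. The path without edges covers the case of a
  loop.\<close>

lemma simple_path_close_cycle:
  assumes p: "simple_path \<Sigma> F a vs es" and F: "F \<subseteq> sedges \<Sigma>"
    and inV: "\<And>f. f \<in> sedges \<Sigma> \<Longrightarrow> ends \<Sigma> f \<subseteq> sverts \<Sigma>"
    and e: "e \<in> sedges \<Sigma>" "e \<notin> F" "ends \<Sigma> e = {a, last vs}"
  shows "is_cycle \<Sigma> vs (es @ [e])"
proof -
  have len: "length vs = Suc (length es)" using p by (simp add: simple_path_def)
  have lst: "last vs = vs ! length es" using len by (subst last_conv_nth) auto
  have ends: "ends \<Sigma> ((es @ [e]) ! i) = {vs ! i, vs ! (Suc i mod length vs)}"
    if "i < length vs" for i
  proof (cases "i = length es")
    case True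
    then show ?thesis using e(3) len lst p by (auto simp: simple_path_def)
  next
    case False
    then show ?thesis using p that len by (simp add: nth_append simple_path_def)
  qed
  have sub: "set (es @ [e]) \<subseteq> sedges \<Sigma>" using p F e(1) by (auto simp: simple_path_def)
  have "vs ! i \<in> sverts \<Sigma>" if "i < length vs" for i
    using ends[OF that] inV[of "(es @ [e]) ! i"] sub that len nth_mem[of i "es @ [e]"] by auto
  then have "set vs \<subseteq> sverts \<Sigma>" by (auto simp: in_set_conv_nth)
  then show ?thesis
    using p ends sub len simple_path_distinct_edges[OF p] e(2)
    unfolding is_cycle_def simple_path_def by auto
qed

context signed_graph
begin

text \<open>Edges are added one at a time. An edge that violates the switching function found so far
  either closes a negative cycle or joins two components, one of which can then be negated.\<close>

lemma balanced_imp_switching: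
  assumes "balanced \<Sigma>"
  shows "\<exists>s. switching \<Sigma> s"
proof -
  have inV: "ends \<Sigma> f \<subseteq> sverts \<Sigma>" if "f \<in> sedges \<Sigma>" for f
    using ends_in_sverts[OF that] by auto
  have "\<exists>s. (\<forall>v. s v \<in> {1, -1}) \<and>
      (\<forall>f\<in>F. \<forall>u v. ends \<Sigma> f = {u, v} \<longrightarrow> esign \<Sigma> f = s u * s v)"
    if "finite F" "F \<subseteq> sedges \<Sigma>" for F
    using that
  proof (induction F rule: finite_induct)
    case empty
    show ?case by (rule exI[of _ "\<lambda>_. 1"]) simp
  next
    case (insert e F)
    then have "F \<subseteq> sedges \<Sigma>" by simp
    from insert.IH[OF this] obtain s where s: "\<And>v. s v \<in> {1, -1}"
        and F: "\<And>f u v. f \<in> F \<Longrightarrow> ends \<Sigma> f = {u, v} \<Longrightarrow> esign \<Sigma> f = s u * s v"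
      by blast
    have e: "e \<in> sedges \<Sigma>" "e \<notin> F" "F \<subseteq> sedges \<Sigma>" using insert by auto
    obtain a b where ab: "ends \<Sigma> e = {a, b}" using ends_in_sverts[OF e(1)] by auto
    show ?case
    proof (cases "esign \<Sigma> e = s a * s b")
      case True
      have "esign \<Sigma> e = s u * s v" if "ends \<Sigma> e = {u, v}" for u v
        using that ab True by (auto simp: doubleton_eq_iff)
      then show ?thesis using s F by (intro exI[of _ s]) auto
    next
      case False
      have neg: "esign \<Sigma> e = - (s a * s b)"
        using False esign_values[OF e(1)] s[of a] s[of b] by auto
      \<comment> \<open>The component of \<open>a\<close> in \<open>F\<close>, described by simple
        paths because a path to \<open>b\<close> must close up to a cycle with distinct
        vertices.\<close>
      define C where "C = {x. \<exists>vs es. simple_path \<Sigma> F a vs es \<and> last vs = x}"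
      have "simple_path \<Sigma> F a [a] []" by (simp add: simple_path_def)
      moreover have "last [a] = a" by simp
      ultimately have "a \<in> C" unfolding C_def by blast
      have C: "v \<in> C" if f: "f \<in> F" "ends \<Sigma> f = {u, v}" "u \<in> C" for f u v
      proof -
        obtain vs es where "simple_path \<Sigma> F a vs es" "last vs = u"
          using f(3) by (auto simp: C_def)
        then show ?thesis using simple_path_extend[of \<Sigma> F a vs es f v] f by (simp add: C_def)
      qed
      have "b \<notin> C"
      proof
        assume "b \<in> C"
        then obtain vs es where p: "simple_path \<Sigma> F a vs es" "last vs = b"
          by (auto simp: C_def)
        have "is_cycle \<Sigma> vs (es @ [e])"
          using simple_path_close_cycle[OF p(1) e(3) inV e(1,2)] ab p(2) by simp
        then have "prod_list (map (esign \<Sigma>) (es @ [e])) = 1"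
          using assms unfolding balanced_def by blast
        moreover have "prod_list (map (esign \<Sigma>) es) = s a * s b"
          using simple_path_sign[OF p(1) s F] p(2) by simp
        ultimately show False using neg s[of a] s[of b] by auto
      qed
      \<comment> \<open>Edges of \<open>F\<close> have both ends in \<open>C\<close> or none, so
        their products are unchanged; \<open>e\<close> has exactly one end in \<open>C\<close>, so
        its product changes sign.\<close>
      define s' where "s' x = (if x \<in> C then - s x else s x)" for x
      have "s' v \<in> {1, -1}" for v using s[of v] by (auto simp: s'_def)
      moreover have "esign \<Sigma> f = s' u * s' v" if f: "f \<in> insert e F" "ends \<Sigma> f = {u, v}" for f u v
      proof (cases "f = e")
        case True
        then have "(u, v) = (a, b) \<or> (u, v) = (b, a)" using f(2) ab by (auto simp: doubleton_eq_iff)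
        then show ?thesis using True neg \<open>a \<in> C\<close> \<open>b \<notin> C\<close> by (auto simp: s'_def)
      next
        case False
        then have "f \<in> F" using f(1) by simp
        moreover have "u \<in> C \<longleftrightarrow> v \<in> C"
          using C[OF \<open>f \<in> F\<close>, of u v] C[OF \<open>f \<in> F\<close>, of v u] f(2) by (auto simp: insert_commute)
        ultimately show ?thesis using F f(2) by (auto simp: s'_def)
      qed
      ultimately show ?thesis by blast
    qed
  qed
  then show ?thesis using finite_sedges unfolding switching_def by blast
qed

section \<open>Balanced sets and adjacency in the conflict graph\<close>

lemma signed_graph_induced: "B \<subseteq> sverts \<Sigma> \<Longrightarrow> signed_graph (induced_sgraph \<Sigma> B)"
proof
  assume B: "B \<subseteq> sverts \<Sigma>"
  show "finite (sverts (induced_sgraph \<Sigma> B))"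
    using B finite_sverts finite_subset by (auto simp: induced_sgraph_def)
  show "finite (sedges (induced_sgraph \<Sigma> B))"
    using finite_sedges by (simp add: induced_sgraph_def)
  show "\<exists>u\<in>sverts (induced_sgraph \<Sigma> B). \<exists>v\<in>sverts (induced_sgraph \<Sigma> B).
      ends (induced_sgraph \<Sigma> B) e = {u, v}" if "e \<in> sedges (induced_sgraph \<Sigma> B)" for e
    using that ends_in_sverts[of e] by (auto simp: induced_sgraph_def)
  show "esign (induced_sgraph \<Sigma> B) e \<in> {1, -1}" if "e \<in> sedges (induced_sgraph \<Sigma> B)" for e
    using that esign_values[of e] by (auto simp: induced_sgraph_def)
  show "esign (induced_sgraph \<Sigma> B) e = 1"
    if "e \<in> sedges (induced_sgraph \<Sigma> B)" "ends (induced_sgraph \<Sigma> B) e = {v}" for e v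
    using that no_negative_loop[of e v] by (auto simp: induced_sgraph_def)
  show "\<exists>e\<in>sedges (induced_sgraph \<Sigma> B).
      ends (induced_sgraph \<Sigma> B) e = {v} \<and> esign (induced_sgraph \<Sigma> B) e = 1"
    if "v \<in> sverts (induced_sgraph \<Sigma> B)" for v
    using that B positive_loop[of v] by (fastforce simp: induced_sgraph_def)
qed

text \<open>Harary's theorem for induced subgraphs; from here on balance is handled through sign
  functions alone.\<close>

lemma balanced_set_iff_switching:
  "balanced_set \<Sigma> B \<longleftrightarrow> B \<subseteq> sverts \<Sigma> \<and> (\<exists>s. switching (induced_sgraph \<Sigma> B) s)"
  using signed_graph.balanced_imp_switching[OF signed_graph_induced] switching_imp_balanced
  unfolding balanced_set_def by blast

text \<open>An unordered pair may match the defining one in either order. This is harmless: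
  \<open>esign \<Sigma> e\<close> is its own inverse, so \<open>r = - esign \<Sigma> e * s\<close>
  is symmetric in \<open>r\<close> and \<open>s\<close>.\<close>

lemma conflict_edge_iff:
  "{(u, s), (v, r)} \<in> snd (conflict_graph \<Sigma>) \<longleftrightarrow>
     s \<in> {1, -1} \<and> (\<exists>e\<in>sedges \<Sigma>. ends \<Sigma> e = {u, v} \<and> r = - esign \<Sigma> e * s)"
  (is "?L \<longleftrightarrow> ?R")
proof
  assume ?L
  then obtain u' s' v' r' e where e: "e \<in> sedges \<Sigma>" "s' \<in> {1, -1}" "ends \<Sigma> e = {u', v'}"
      "r' = - esign \<Sigma> e * s'" "{(u, s), (v, r)} = {(u', s'), (v', r')}"
    unfolding conflict_graph_def snd_conv mem_Collect_eq by blast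
  have "esign \<Sigma> e \<in> {1, -1}" using esign_values[OF e(1)] .
  with e show ?R by (auto simp: doubleton_eq_iff insert_commute)
next
  assume ?R
  then show ?L
    unfolding conflict_graph_def snd_conv
    by (intro CollectI exI[of _ u] exI[of _ s] exI[of _ v] exI[of _ r] conjI refl) simp_all
qed

end

section \<open>Projecting the stable set polytope\<close>

lemma lookup_proj:
  assumes "finite (sverts \<Sigma>)"
  shows "Poly_Mapping.lookup (proj \<Sigma> y) v =
    (if v \<in> sverts \<Sigma> then Poly_Mapping.lookup y (v, 1) + Poly_Mapping.lookup y (v, -1) else 0)"
  using assms by (simp add: proj_def lookup_sum lookup_single when_def)

lemma linear_proj: "finite (sverts \<Sigma>) \<Longrightarrow> linear (proj \<Sigma>)"
  by (rule linearI; rule poly_mapping_eqI) (simp_all add: lookup_proj lookup_add distrib_left)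

text \<open>A stable set meets a clique at most once, so its indicator vector satisfies the clique
  inequalities; \<open>qstab\<close> is convex.\<close>

lemma stab_subset_qstab:
  assumes fin: "finite (fst H)"
  shows "stab H \<subseteq> qstab H"
  unfolding stab_def
proof (rule hull_minimal)
  show "{indicator_vec S |S. stable_set H S} \<subseteq> qstab H"
  proof clarify
    fix S assume S: "stable_set H S"
    then have finS: "finite S" using fin finite_subset by (auto simp: stable_set_def)
    have "(\<Sum>v\<in>K. Poly_Mapping.lookup (indicator_vec S) v) \<le> 1" if K: "is_clique H K" for K
    proof -
      have "finite K" using K fin finite_subset by (auto simp: is_clique_def)
      then have "(\<Sum>v\<in>K. Poly_Mapping.lookup (indicator_vec S) v) = real (card (K \<inter> S))"
        by (simp add: lookup_indicator_vec[OF finS] sum.If_cases)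
      then show ?thesis using card_clique_Int_stable_set[OF K S] by simp
    qed
    moreover have "Poly_Mapping.keys (indicator_vec S) \<subseteq> fst H"
      using S by (auto simp: in_keys_iff lookup_indicator_vec[OF finS] stable_set_def
        split: if_splits)
    ultimately show "indicator_vec S \<in> qstab H"
      by (simp add: qstab_def lookup_indicator_vec[OF finS])
  qed
  show "convex (qstab H)"
  proof (rule convexI)
    fix x y :: "'a \<Rightarrow>\<^sub>0 real" and a b :: real
    assume xy: "x \<in> qstab H" "y \<in> qstab H" and ab: "0 \<le> a" "0 \<le> b" "a + b = 1"
    let ?z = "a *\<^sub>R x + b *\<^sub>R y"
    have "Poly_Mapping.lookup ?z v = 0" if "v \<notin> fst H" for v
      using xy that not_in_keys_iff_lookup_eq_zero[of v x] not_in_keys_iff_lookup_eq_zero[of v y]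
      by (auto simp: qstab_def lookup_add)
    then have "Poly_Mapping.keys ?z \<subseteq> fst H"
      by (meson in_keys_iff subsetI)
    moreover have "(\<Sum>v\<in>K. Poly_Mapping.lookup ?z v) \<le> 1" if K: "is_clique H K" for K
    proof -
      have "(\<Sum>v\<in>K. Poly_Mapping.lookup ?z v)
          = a * (\<Sum>v\<in>K. Poly_Mapping.lookup x v) + b * (\<Sum>v\<in>K. Poly_Mapping.lookup y v)"
        by (simp add: lookup_add sum.distrib sum_distrib_left)
      also have "\<dots> \<le> a * 1 + b * 1"
        using xy K ab by (intro add_mono mult_left_mono) (auto simp: qstab_def)
      finally show ?thesis using ab by simp
    qed
    ultimately show "?z \<in> qstab H"
      using xy ab by (simp add: qstab_def lookup_add)
  qed
qed

context signed_graph
begin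

text \<open>The graph of a switching function on \<open>B\<close> is stable, since a conflict edge
  would demand the opposite edge sign.\<close>

lemma balanced_set_lift:
  assumes "balanced_set \<Sigma> B"
  shows "\<exists>S. stable_set (conflict_graph \<Sigma>) S \<and> proj \<Sigma> (indicator_vec S) = indicator_vec B"
proof -
  from assms obtain s where B: "B \<subseteq> sverts \<Sigma>" and s: "switching (induced_sgraph \<Sigma> B) s"
    by (auto simp: balanced_set_iff_switching)
  have fin: "finite B" using B finite_sverts finite_subset by blast
  have val: "s v \<in> {1, -1}" for v using s by (simp add: switching_def)
  define S where "S = (\<lambda>v. (v, s v)) ` B"
  have "{(u, s u), (v, s v)} \<notin> snd (conflict_graph \<Sigma>)" if "u \<in> B" "v \<in> B" for u v
  proof
    assume "{(u, s u), (v, s v)} \<in> snd (conflict_graph \<Sigma>)"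
    then obtain e where e: "e \<in> sedges \<Sigma>" "ends \<Sigma> e = {u, v}" "s v = - esign \<Sigma> e * s u"
      unfolding conflict_edge_iff by auto
    then have "esign \<Sigma> e = s u * s v"
      using s that by (auto simp: switching_def induced_sgraph_def)
    then show False using e(3) val[of u] val[of v] by auto
  qed
  moreover have "(v, s v) \<in> fst (conflict_graph \<Sigma>)" if "v \<in> B" for v
    using that B val[of v] by (auto simp: conflict_graph_def)
  ultimately have "stable_set (conflict_graph \<Sigma>) S"
    unfolding stable_set_def indep_def S_def by blast
  moreover have "proj \<Sigma> (indicator_vec S) = indicator_vec B"
  proof (rule poly_mapping_eqI)
    fix v
    have "finite S" using fin by (simp add: S_def)
    then show "Poly_Mapping.lookup (proj \<Sigma> (indicator_vec S)) v
        = Poly_Mapping.lookup (indicator_vec B) v"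
      using val[of v] B
      by (auto simp: lookup_proj[OF finite_sverts] lookup_indicator_vec fin S_def)
  qed
  ultimately show ?thesis by blast
qed

text \<open>Conversely, a stable set contains at most one copy of each vertex, so it is the graph of
  a sign function on its shadow; nonadjacency makes this function a switching.\<close>

lemma stable_set_proj:
  assumes S: "stable_set (conflict_graph \<Sigma>) S"
  shows "balanced_set \<Sigma> (fst ` S) \<and> proj \<Sigma> (indicator_vec S) = indicator_vec (fst ` S)"
proof
  have sub: "S \<subseteq> sverts \<Sigma> \<times> {1, -1}"
    using S by (auto simp: stable_set_def conflict_graph_def)
  then have finS: "finite S" using finite_sverts finite_subset by blast
  \<comment> \<open>\<open>indep\<close> is silent about \<open>p = q\<close>. That case arises from
    loops of the signed graph and holds because the conflict graph is simple.\<close>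
  have nonadj: "{p, q} \<notin> snd (conflict_graph \<Sigma>)" if "p \<in> S" "q \<in> S" for p q
  proof (cases "p = q")
    case True
    then show ?thesis using simple_graph_conflict_graph by (fastforce simp: simple_graph_def)
  next
    case False
    then show ?thesis using that S by (auto simp: stable_set_def indep_def)
  qed
  \<comment> \<open>Over the shadow of \<open>S\<close>, failure of \<open>(v, 1) \<in> S\<close>
    forces \<open>(v, -1) \<in> S\<close>; elsewhere -1 is an arbitrary default.\<close>
  define s where "s v = (if (v, 1) \<in> S then 1 else -1 :: int)" for v
  have lift: "(v, s v) \<in> S" if "v \<in> fst ` S" for v
    using that sub by (auto simp: s_def)
  have val: "s v \<in> {1, -1}" for v by (simp add: s_def)
  have "esign \<Sigma> e = s u * s v"
    if e: "e \<in> sedges \<Sigma>" "ends \<Sigma> e = {u, v}" and uv: "u \<in> fst ` S" "v \<in> fst ` S" for e u v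
  proof -
    have "s v \<noteq> - esign \<Sigma> e * s u"
      using nonadj[OF lift lift, OF uv] e val[of u] unfolding conflict_edge_iff by blast
    then show ?thesis using esign_values[OF e(1)] val[of u] val[of v] by auto
  qed
  then have "switching (induced_sgraph \<Sigma> (fst ` S)) s"
    using val unfolding switching_def induced_sgraph_def by auto
  then show "balanced_set \<Sigma> (fst ` S)"
    using sub by (auto simp: balanced_set_iff_switching)
  have one: "\<not> ((v, 1) \<in> S \<and> (v, -1) \<in> S)" for v
  proof
    assume v: "(v, 1) \<in> S \<and> (v, -1) \<in> S"
    then have "v \<in> sverts \<Sigma>" using sub by auto
    from positive_loop[OF this] have "{(v, 1), (v, -1)} \<in> snd (conflict_graph \<Sigma>)"
      unfolding conflict_edge_iff by force
    then show False using nonadj v by blast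
  qed
  show "proj \<Sigma> (indicator_vec S) = indicator_vec (fst ` S)"
  proof (rule poly_mapping_eqI)
    fix v
    have "v \<in> fst ` S \<longleftrightarrow> (v, 1) \<in> S \<or> (v, -1) \<in> S" using sub by force
    moreover have "v \<in> fst ` S \<Longrightarrow> v \<in> sverts \<Sigma>" using sub by auto
    ultimately show "Poly_Mapping.lookup (proj \<Sigma> (indicator_vec S)) v
        = Poly_Mapping.lookup (indicator_vec (fst ` S)) v"
      using one[of v] finS by (auto simp: lookup_proj[OF finite_sverts] lookup_indicator_vec)
  qed
qed

text \<open>The generators of the two hulls correspond under \<open>proj\<close>, and a linear map
  commutes with convex hulls.\<close>

lemma bstab_eq_proj_stab: "bstab \<Sigma> = proj \<Sigma> ` stab (conflict_graph \<Sigma>)"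
proof -
  have "proj \<Sigma> ` {indicator_vec S | S. stable_set (conflict_graph \<Sigma>) S}
      = {indicator_vec B | B. balanced_set \<Sigma> B}" (is "?L = ?R")
  proof
    show "?L \<subseteq> ?R" using stable_set_proj by blast
    show "?R \<subseteq> ?L" using balanced_set_lift by (clarsimp simp: image_iff) metis
  qed
  then show ?thesis
    unfolding bstab_def stab_def
    by (simp add: convex_hull_linear_image[OF linear_proj[OF finite_sverts]])
qed

lemma bstab_subset_bqstab: "bstab \<Sigma> \<subseteq> bqstab \<Sigma>"
  using stab_subset_qstab[of "conflict_graph \<Sigma>"] simple_graph_conflict_graph
  unfolding bstab_eq_proj_stab bqstab_def simple_graph_def by blast

theorem perfect_imp_balanced_perfect:
  assumes "perfect (conflict_graph \<Sigma>)"
  shows "balanced_perfect \<Sigma>"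
  using perfect_qstab_subset_stab[OF simple_graph_conflict_graph assms] bstab_subset_bqstab
  unfolding balanced_perfect_def bstab_eq_proj_stab bqstab_def by blast

end

section \<open>A balanced-perfect signed graph with imperfect conflict graph\<close>

text \<open>A triangle on \<open>0, 1, 2\<close> with the single negative edge \<open>01\<close>, and a further vertex \<open>3\<close>
  joined by positive edges to \<open>1\<close> and \<open>2\<close>.\<close>

definition kite :: "(nat, nat) sgraph" where
  "kite = \<lparr>sverts = {0, 1, 2, 3}, sedges = {..<9},
     ends = (\<lambda>e. [{0}, {1}, {2}, {3}, {0, 1}, {0, 2}, {1, 2}, {1, 3}, {2, 3}] ! e),
     esign = (\<lambda>e. if e = 4 then -1 else 1)\<rparr>"

lemma sedges_kite: "sedges kite = {0, 1, 2, 3, 4, 5, 6, 7, 8}"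
  unfolding kite_def by auto

lemma sverts_kite: "sverts kite = {0, 1, 2, 3}"
  by (simp add: kite_def)

lemma ends_kite:
  "ends kite 0 = {0}" "ends kite (Suc 0) = {1}" "ends kite 2 = {2}" "ends kite 3 = {3}"
  "ends kite 4 = {0, 1}" "ends kite 5 = {0, 2}" "ends kite 6 = {1, 2}" "ends kite 7 = {1, 3}"
  "ends kite 8 = {2, 3}"
  by (simp_all add: kite_def)

lemma esign_kite: "esign kite e = (if e = 4 then -1 else 1)"
  by (simp add: kite_def)

interpretation kite: signed_graph kite
proof
  show "finite (sverts kite)" "finite (sedges kite)"
    by (simp_all add: sverts_kite sedges_kite)
  show "\<exists>u\<in>sverts kite. \<exists>v\<in>sverts kite. ends kite e = {u, v}" if "e \<in> sedges kite" for e
    using that unfolding sedges_kite insert_iff empty_iff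
    by (elim disjE) (simp_all add: ends_kite sverts_kite doubleton_eq_iff)
  show "esign kite e \<in> {1, -1}" for e by (simp add: esign_kite)
  show "esign kite e = 1" if "ends kite e = {v}" for e v
    using that by (auto simp: esign_kite ends_kite)
  show "\<exists>e\<in>sedges kite. ends kite e = {v} \<and> esign kite e = 1" if "v \<in> sverts kite" for v
    \<comment> \<open>Edges 0 to 3 are numbered like the vertices at which they are loops.\<close>
    using that by (intro bexI[of _ v]) (auto simp: sverts_kite sedges_kite ends_kite esign_kite)
qed

section \<open>Imperfection of the conflict graph of \<open>kite\<close>\<close>

lemma kite_edge_iff:
  "{(u, s), (v, r)} \<in> snd (conflict_graph kite) \<longleftrightarrow> s \<in> {1, -1} \<and>
     (\<exists>e\<in>{0, 1, 2, 3, 4, 5, 6, 7, 8}. ends kite e = {u, v} \<and> r = (if e = 4 then s else - s))"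
proof -
  have "- esign kite e * s = (if e = 4 then s else - s)" for e by (simp add: esign_kite)
  then show ?thesis by (simp only: kite.conflict_edge_iff sedges_kite)
qed

text \<open>An induced 5-cycle has no clique of more than two vertices, so
  \<open>perfect_colouring\<close> with \<open>q = 2\<close> would colour this odd cycle with two
  colours.\<close>

lemma kite_not_perfect: "\<not> perfect (conflict_graph kite)"
proof
  assume perfect: "perfect (conflict_graph kite)"
  let ?E = "snd (conflict_graph kite)"
  \<comment> \<open>\<open>?W\<close> induces a 5-cycle in the conflict graph.\<close>
  let ?W = "{(0, 1), (0, -1), (1, -1), (3, 1), (2, -1)} :: (nat \<times> int) set"
  \<comment> \<open>These edges come in turn from the loop at 0, the negative edge 01, and the
    positive edges 13, 23 and 02.\<close>
  have adj: "{(0, 1), (0, -1)} \<in> ?E" "{(0, -1), (1, -1)} \<in> ?E" "{(1, -1), (3, 1)} \<in> ?E"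
      "{(3, 1), (2, -1)} \<in> ?E" "{(2, -1), (0, 1)} \<in> ?E"
    unfolding kite_edge_iff by (simp_all add: ends_kite insert_commute doubleton_eq_iff)
  have nonadj: "{(0, 1), (1, -1)} \<notin> ?E" "{(0, 1), (3, 1)} \<notin> ?E" "{(0, -1), (3, 1)} \<notin> ?E"
      "{(0, -1), (2, -1)} \<notin> ?E" "{(1, -1), (2, -1)} \<notin> ?E"
    unfolding kite_edge_iff by (simp_all add: ends_kite doubleton_eq_iff)
  have W: "?W \<subseteq> fst (conflict_graph kite)" by (simp add: conflict_graph_def sverts_kite)
  have "card K \<le> 2" if K: "is_clique (conflict_graph kite) K" "K \<subseteq> ?W" for K
  proof -
    have no: "\<not> (p \<in> K \<and> q \<in> K)" if "{p, q} \<notin> ?E" "p \<noteq> q" for p q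
      using K(1) that unfolding is_clique_def clique_def by blast
    have "\<not> ((0, 1) \<in> K \<and> (1, -1) \<in> K)" "\<not> ((0, 1) \<in> K \<and> (3, 1) \<in> K)"
        "\<not> ((0, -1) \<in> K \<and> (3, 1) \<in> K)" "\<not> ((0, -1) \<in> K \<and> (2, -1) \<in> K)"
        "\<not> ((1, -1) \<in> K \<and> (2, -1) \<in> K)"
      using nonadj[THEN no] by simp_all
    \<comment> \<open>Each case leaves only two consecutive vertices of the 5-cycle for
      \<open>K\<close>.\<close>
    then consider "(1, -1) \<notin> K" "(3, 1) \<notin> K" "(2, -1) \<notin> K"
      | "(3, 1) \<notin> K" "(2, -1) \<notin> K" "(0, 1) \<notin> K"
      | "(2, -1) \<notin> K" "(0, 1) \<notin> K" "(0, -1) \<notin> K"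
      | "(0, 1) \<notin> K" "(0, -1) \<notin> K" "(1, -1) \<notin> K"
      | "(0, -1) \<notin> K" "(1, -1) \<notin> K" "(3, 1) \<notin> K"
      by argo
    then have "\<exists>p q. K \<subseteq> {p, q}" using K(2) by cases blast+
    then obtain p q where "K \<subseteq> {p, q}" by blast
    then have "card K \<le> card {p, q}" by (intro card_mono) auto
    also have "\<dots> \<le> 2" by (simp add: card_insert_if)
    finally show ?thesis .
  qed
  then obtain c where c: "proper_colouring (induced_subgraph (conflict_graph kite) ?W) 2 c"
    using perfect_colouring[OF kite.simple_graph_conflict_graph perfect W] by blast
  have "c p < 2" if "p \<in> ?W" for p
    using c that unfolding proper_colouring_def induced_subgraph_def by auto
  then have lt: "c (0, 1) < 2" "c (0, -1) < 2" "c (1, -1) < 2" "c (3, 1) < 2" "c (2, -1) < 2"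
    by simp_all
  have ne: "c p \<noteq> c q" if "{p, q} \<in> ?E" "p \<in> ?W" "q \<in> ?W" for p q
  proof -
    have "{p, q} \<subseteq> ?W" using that(2,3) by blast
    then show ?thesis
      using c that unfolding proper_colouring_def induced_subgraph_def fst_conv snd_conv by blast
  qed
  have "c (0, 1) \<noteq> c (0, -1)" "c (0, -1) \<noteq> c (1, -1)" "c (1, -1) \<noteq> c (3, 1)"
      "c (3, 1) \<noteq> c (2, -1)" "c (2, -1) \<noteq> c (0, 1)"
    using adj[THEN ne] by simp_all
  then show False using lt by linarith
qed

section \<open>The two polytopes of \<open>kite\<close>\<close>

lemma kite_balanced_set:
  assumes "B \<subseteq> {0, 1, 2, 3}" "\<not> {0, 1, 2} \<subseteq> B"
  shows "balanced_set kite B"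
proof -
  \<comment> \<open>If 2 is missing, 01 is the only edge other than a loop that can remain at 0, so
    0 is negated. If 2 is present, 0 or 1 is missing and every remaining edge is positive.\<close>
  define s :: "nat \<Rightarrow> int" where "s v = (if v = 0 \<and> 2 \<notin> B then -1 else 1)" for v
  have "esign kite e = s u * s v"
    if e: "e \<in> sedges kite" "ends kite e = {u, v}" and uv: "u \<in> B" "v \<in> B" for e u v
  proof -
    have "(e < 4 \<and> (\<exists>w. ends kite e = {w})) \<or> (e = 4 \<and> ends kite e = {0, 1})
        \<or> (e = 5 \<and> ends kite e = {0, 2}) \<or> (5 < e \<and> 0 \<notin> ends kite e)"
      using e(1) unfolding sedges_kite insert_iff empty_iff
      by (elim disjE) (simp_all add: ends_kite)
    then have "(e < 4 \<and> u = v) \<or> (e = 4 \<and> {u, v} = {0, 1}) \<or> (e = 5 \<and> {u, v} = {0, 2})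
        \<or> (5 < e \<and> u \<noteq> 0 \<and> v \<noteq> 0)"
      unfolding e(2) by auto
    then show ?thesis
      using assms(2) uv by (auto simp: esign_kite s_def doubleton_eq_iff)
  qed
  then have "switching (induced_sgraph kite B) s"
    unfolding switching_def induced_sgraph_def by (auto simp: s_def)
  then show ?thesis
    using assms(1) by (auto simp: kite.balanced_set_iff_switching sverts_kite)
qed

definition vec4 :: "real \<Rightarrow> real \<Rightarrow> real \<Rightarrow> real \<Rightarrow> (nat \<Rightarrow>\<^sub>0 real)" where
  "vec4 a b c d = Poly_Mapping.single 0 a + Poly_Mapping.single 1 b
     + Poly_Mapping.single 2 c + Poly_Mapping.single 3 d"

lemma lookup_vec4: "Poly_Mapping.lookup (vec4 a b c d) v =
    (if v = 0 then a else if v = 1 then b else if v = 2 then c else if v = 3 then d else 0)"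
  by (simp add: vec4_def lookup_add lookup_single when_def)

lemma vec4_convex_comb:
  assumes "convex S" "vec4 a b c d \<in> S" "vec4 a' b' c' d' \<in> S" "0 \<le> t" "t \<le> 1"
  shows "vec4 ((1 - t) * a + t * a') ((1 - t) * b + t * b')
    ((1 - t) * c + t * c') ((1 - t) * d + t * d') \<in> S"
proof -
  have "(1 - t) *\<^sub>R vec4 a b c d + t *\<^sub>R vec4 a' b' c' d' \<in> S"
    using assms by (intro convexD) auto
  also have "(1 - t) *\<^sub>R vec4 a b c d + t *\<^sub>R vec4 a' b' c' d'
      = vec4 ((1 - t) * a + t * a') ((1 - t) * b + t * b')
          ((1 - t) * c + t * c') ((1 - t) * d + t * d')"
    by (rule poly_mapping_eqI) (simp add: lookup_add lookup_vec4)
  finally show ?thesis .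
qed

lemma convex_bstab: "convex (bstab \<Sigma>)"
  by (simp add: bstab_def convex_convex_hull)

text \<open>The region is a 3-cube with one corner cut off, times a segment. Over fixed
  \<open>a\<close>, \<open>b\<close>, \<open>d\<close> the point lies on a segment in the third
  coordinate, from the face \<open>c = 0\<close> up to the face \<open>c = 1\<close> or the cut
  \<open>a + b + c = 2\<close>. Points of these faces are interpolated from 0/1 corners.\<close>

lemma vec4_mem_bstab_kite:
  assumes range: "a \<in> {0..1}" "b \<in> {0..1}" "c \<in> {0..1}" "d \<in> {0..1}" and sum: "a + b + c \<le> 2"
  shows "vec4 a b c d \<in> bstab kite"
proof -
  note mix = vec4_convex_comb[OF convex_bstab[of kite]]
  have corner: "vec4 p q r s \<in> bstab kite"
    if "p \<in> {0, 1}" "q \<in> {0, 1}" "r \<in> {0, 1}" "s \<in> {0, 1}" "p + q + r \<noteq> 3" for p q r s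
  proof -
    define B where "B = {v. Poly_Mapping.lookup (vec4 p q r s) v = 1}"
    have sub: "B \<subseteq> {0, 1, 2, 3}" by (auto simp: B_def lookup_vec4 split: if_splits)
    then have "finite B" using finite_subset by blast
    then have "vec4 p q r s = indicator_vec B"
      using that by (intro poly_mapping_eqI) (auto simp: lookup_indicator_vec B_def lookup_vec4)
    moreover have "balanced_set kite B"
      using sub that(5) by (intro kite_balanced_set) (auto simp: B_def lookup_vec4)
    ultimately show ?thesis unfolding bstab_def by (auto intro: hull_inc)
  qed
  have line: "vec4 p q r d \<in> bstab kite"
    if "p \<in> {0, 1}" "q \<in> {0, 1}" "r \<in> {0, 1}" "p + q + r \<noteq> 3" for p q r
    using mix[OF corner[of p q r 0] corner[of p q r 1], of d] that range(4)
    by (simp add: algebra_simps)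
  have edge: "vec4 a q r d \<in> bstab kite" if "q \<in> {0, 1}" "r \<in> {0, 1}" "q + r \<noteq> 2" for q r
    using mix[OF line[of 0 q r] line[of 1 q r], of a] that range(1)
    by (auto simp: algebra_simps)
  have bottom: "vec4 a b 0 d \<in> bstab kite"
    using mix[OF edge[of 0 0] edge[of 1 0], of b] range(2) by (simp add: algebra_simps)
  \<comment> \<open>This face is a triangle: the point lies between the corner \<open>a = 1\<close>
    and a point of the opposite side \<open>a = 0\<close>. The corner itself is treated apart, as
    \<open>1 - a\<close> vanishes there.\<close>
  have top: "vec4 a b 1 d \<in> bstab kite" if ab: "a + b \<le> 1"
  proof (cases "a = 1")
    case True
    then show ?thesis using line[of 1 0 1] ab range by simp
  next
    case False
    then have "a < 1" using range(1) by simp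
    then have "b / (1 - a) \<in> {0..1}" using ab range by (simp add: divide_simps)
    then have "vec4 0 (b / (1 - a)) 1 d \<in> bstab kite"
      using mix[OF line[of 0 0 1] line[of 0 1 1], of "b / (1 - a)"] by (simp add: algebra_simps)
    from mix[OF this line[of 1 0 1], of a]
    have "vec4 a ((1 - a) * (b / (1 - a))) 1 d \<in> bstab kite"
      using range(1) by (simp add: left_diff_distrib)
    then show ?thesis using \<open>a < 1\<close> by simp
  qed
  \<comment> \<open>The cut is a triangle with corners (0,1,1), (1,1,0), (1,0,1): the point lies
    between the first and a point of the side \<open>a = 1\<close>. At \<open>a = 0\<close> the
    bounds force \<open>b = 1\<close>.\<close>
  have slant: "vec4 a b (2 - a - b) d \<in> bstab kite" if ab: "1 \<le> a + b"
  proof (cases "a = 0")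
    case True
    then show ?thesis using line[of 0 1 1] ab range by simp
  next
    case False
    then have "a > 0" using range(1) by simp
    then have t: "(1 - b) / a \<in> {0..1}" using ab range by (simp add: divide_simps)
    have "vec4 1 (1 - (1 - b) / a) ((1 - b) / a) d \<in> bstab kite"
      using mix[OF line[of 1 1 0] line[of 1 0 1], of "(1 - b) / a"] t by (simp add: algebra_simps)
    from mix[OF line[of 0 1 1] this, of a]
    have "vec4 a (1 - a * ((1 - b) / a)) (1 - a + a * ((1 - b) / a)) d \<in> bstab kite"
      using range(1) by (simp add: algebra_simps)
    moreover have "a * ((1 - b) / a) = 1 - b" using \<open>a > 0\<close> by simp
    moreover have "1 - a + (1 - b) = 2 - a - b" by simp
    ultimately show ?thesis by (simp only: diff_diff_eq2 add_diff_cancel_left')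
  qed
  \<comment> \<open>The largest third coordinate allowed over \<open>a\<close> and \<open>b\<close>;
    if it is 0, the point already lies on the bottom face.\<close>
  define m where "m = min 1 (2 - a - b)"
  have m: "vec4 a b m d \<in> bstab kite" "c \<le> m"
    using top slant range sum by (auto simp: m_def min_def)
  show ?thesis
  proof (cases "m = 0")
    case True
    then show ?thesis using bottom m range by simp
  next
    case False
    then have "m > 0" using m(2) range(3) by simp
    then have "c / m \<in> {0..1}" using m(2) range(3) by (simp add: divide_simps)
    with mix[OF bottom m(1), of "c / m"] have "vec4 a b (c / m * m) d \<in> bstab kite"
      by (simp add: left_diff_distrib del: times_divide_eq_left)
    then show ?thesis using \<open>m > 0\<close> by simp
  qed
qed

text \<open>The cliques \<open>{(0, s), (1, s), (2, -s)}\<close> for \<open>s = 1, -1\<close> together yield the inequality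
  of the negative triangle.\<close>

lemma bqstab_kite_subset: "bqstab kite \<subseteq> bstab kite"
proof
  fix x assume "x \<in> bqstab kite"
  then obtain y where y: "y \<in> qstab (conflict_graph kite)" and x: "x = proj kite y"
    by (auto simp: bqstab_def)
  let ?y = "Poly_Mapping.lookup y"
  let ?x = "Poly_Mapping.lookup x"
  have lx: "?x v = (if v \<in> {0, 1, 2, 3} then ?y (v, 1) + ?y (v, -1) else 0)" for v
    unfolding x lookup_proj[OF kite.finite_sverts] sverts_kite by simp
  have pos: "0 \<le> ?y (v, s)" if "v \<in> {0, 1, 2, 3}" "s \<in> {1, -1}" for v s
    using y that by (auto simp: qstab_def conflict_graph_def sverts_kite)
  have cl: "sum ?y K \<le> 1"
    if "K \<subseteq> {0, 1, 2, 3} \<times> {1, -1}" "clique K (snd (conflict_graph kite))" for K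
    using y that by (simp add: qstab_def is_clique_def) (simp add: conflict_graph_def sverts_kite)
  \<comment> \<open>The two copies of \<open>v\<close> form a clique through the positive
    loop.\<close>
  have le1: "?x v \<le> 1" if v: "v \<in> {0, 1, 2, 3}" for v
  proof -
    have "clique {(v, 1), (v, -1)} (snd (conflict_graph kite))"
      using v unfolding clique_def by (auto simp: kite_edge_iff ends_kite)
    with cl[of "{(v, 1), (v, -1)}"] show ?thesis using v by (simp add: lx)
  qed
  have ge0: "0 \<le> ?x v" for v using pos by (simp add: lx)
  have tri: "?y (0, s) + ?y (1, s) + ?y (2, - s) \<le> 1" if s: "s \<in> {1, -1}" for s
  proof -
    have "clique {(0, s), (1, s), (2, - s)} (snd (conflict_graph kite))"
      using s unfolding clique_def by (auto simp: kite_edge_iff ends_kite doubleton_eq_iff)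
    moreover have "{(0, s), (1, s), (2, - s)} \<subseteq> {0, 1, 2, 3} \<times> {1, -1}" using s by auto
    ultimately have "sum ?y {(0, s), (1, s), (2, - s)} \<le> 1" using cl by blast
    then show ?thesis by simp
  qed
  have "?x 0 + ?x 1 + ?x 2 \<le> 2" using tri[of 1] tri[of "-1"] by (simp add: lx)
  then have "vec4 (?x 0) (?x 1) (?x 2) (?x 3) \<in> bstab kite"
    using le1 ge0 by (intro vec4_mem_bstab_kite) auto
  also have "vec4 (?x 0) (?x 1) (?x 2) (?x 3) = x"
    by (rule poly_mapping_eqI) (simp add: lookup_vec4 lx)
  finally show "x \<in> bstab kite" .
qed

theorem theorem8p2:
  shows "(\<forall>\<Sigma> :: ('v, 'e) sgraph.
            signed_graph \<Sigma> \<longrightarrow> perfect (conflict_graph \<Sigma>) \<longrightarrow> balanced_perfect \<Sigma>)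
       \<and> (\<exists>\<Sigma> :: (nat, nat) sgraph.
            signed_graph \<Sigma> \<and> balanced_perfect \<Sigma> \<and> \<not> perfect (conflict_graph \<Sigma>))"
proof (intro conjI allI impI exI)
  show "balanced_perfect \<Sigma>" if "signed_graph \<Sigma>" "perfect (conflict_graph \<Sigma>)"
    for \<Sigma> :: "('v, 'e) sgraph"
    using that by (rule signed_graph.perfect_imp_balanced_perfect)
  show "signed_graph kite" by (rule kite.signed_graph_axioms)
  show "balanced_perfect kite"
    using bqstab_kite_subset kite.bstab_subset_bqstab by (auto simp: balanced_perfect_def)
  show "\<not> perfect (conflict_graph kite)" by (rule kite_not_perfect)
qed

end
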